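(* Let $n\geq 2$ and let $v_1,v_2,\dots,v_{n+2}$ be points in $n$-dimensional hyperbolic space $H^n$, with distance function $\varrho$. Let $B$ be the $(n+2)\times(n+2)$ matrix with entries $B_{ij}=\sinh^2\tfrac12\varrho(v_i,v_j)$. Then $v_1,v_2,\dots,v_{n+2}$ lie on a common horosphere, a common hypersphere, a common hyperplane, or one branch of an equidistant hypersurface if and only if $\det B=0$.
   Context: A branch of an equidistant hypersurface is one of the two connected components of the locus of points in $H^n$ equidistant (at a fixed positive distance) from some hyperplane. Lorentzian model: let $\mathbb{R}^{n,1}$ be $\mathbb{R}^{n+1}$ with the inner product $\langle x,y\rangle=x_1y_1+\dots+x_ny_n-x_{n+1}y_{n+1}$, and let $\|x\|^2=\langle x,x\rangle$. A vector $x$ is spacelike if $\|x\|^2>0$ and lightlike if $\|x\|^2=0$. Then $H^n$ is modelled by $\mathcal{H}^n=\{x\in\mathbb{R}^{n,1}:\|x\|^2=-1,\ x_{n+1}>0\}$ with distance function $\varrho$ given by $\cosh\varrho(x,y)=-\langle x,y\rangle$. A hyperplane in $\mathcal{H}^n$ is the nonempty intersection of $\mathcal{H}^n$ with a codimension 1 subspace of $\mathbb{R}^{n,1}$. A hypersphere in $\mathcal{H}^n$ is a set $\{x\in\mathcal{H}^n:\varrho(x,c)=r\}$ for some $c\in\mathcal{H}^n$ and $r>0$. A horosphere in $\mathcal{H}^n$ is a (nonempty) set $\{x\in\mathcal{H}^n:\langle x,v\rangle=-1/\sqrt2\}$, where $v$ is a (nonzero) lightlike vector. In this model a branch of an equidistant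 hypersurface is a set $\{x\in\mathcal{H}^n:\langle x,v\rangle=\lambda\}$, where $v$ is spacelike and $\lambda\neq 0$. *)

theory Defs
  imports "HOL-Analysis.Analysis"
begin

type_synonym 'n lorentz = "(real ^ 'n) \<times> real"

definition lorentz_inner :: "'n::finite lorentz \<Rightarrow> 'n lorentz \<Rightarrow> real" where
  "lorentz_inner x y = fst x \<bullet> fst y - snd x * snd y"

definition lightlike :: "'n::finite lorentz \<Rightarrow> bool" where
  "lightlike x \<longleftrightarrow> lorentz_inner x x = 0"

definition hyperboloid :: "'n::finite lorentz set" where
  "hyperboloid = {x. lorentz_inner x x = -1 \<and> snd x > 0}"

text \<open>For points of the hyperboloid the argument of \<^const>\<open>arcosh\<close> is at least 1, so this is the
  unique nonnegative number whose hyperbolic cosine is the negated Lorentzian product.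
  Nothing is intended off the hyperboloid.\<close>

definition hdist :: "'n::finite lorentz \<Rightarrow> 'n lorentz \<Rightarrow> real" where
  "hdist x y = arcosh (- lorentz_inner x y)"

definition hyp_hyperplane :: "'n::finite lorentz set \<Rightarrow> bool" where
  "hyp_hyperplane P \<longleftrightarrow>
     P \<noteq> {} \<and> (\<exists>W. subspace W \<and> dim W + 1 = DIM('n lorentz) \<and> P = hyperboloid \<inter> W)"

definition hyp_hypersphere :: "'n::finite lorentz set \<Rightarrow> bool" where
  "hyp_hypersphere S \<longleftrightarrow>
     (\<exists>c\<in>hyperboloid. \<exists>r>0. S = {x \<in> hyperboloid. hdist x c = r})"

definition hyp_horosphere :: "'n::finite lorentz set \<Rightarrow> bool" where
  "hyp_horosphere S \<longleftrightarrow>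
     S \<noteq> {} \<and> (\<exists>v. v \<noteq> 0 \<and> lightlike v \<and>
                   S = {x \<in> hyperboloid. lorentz_inner x v = - 1 / sqrt 2})"

definition hdist_to_set :: "'n::finite lorentz \<Rightarrow> 'n lorentz set \<Rightarrow> real" where
  "hdist_to_set x P = (INF p\<in>P. hdist x p)"

text \<open>The topology that \<^const>\<open>hdist\<close> induces on the hyperboloid is the subspace topology of the
  ambient Euclidean topology, so \<^const>\<open>components\<close> gives the intended connected components.
  In dimension at least 2 the locus below has exactly two of them, given in the hyperboloid by
  \<open>lorentz_inner x v = c\<close> and \<open>lorentz_inner x v = - c\<close> for some
  \<open>v\<close> with \<open>lorentz_inner v v > 0\<close> and some \<open>c > 0\<close>.\<close>

definition equidistant_branch :: "'n::finite lorentz set \<Rightarrow> bool" where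
  "equidistant_branch S \<longleftrightarrow>
     (\<exists>P r. hyp_hyperplane P \<and> r > 0 \<and>
            S \<in> components {x \<in> hyperboloid. hdist_to_set x P = r})"

end

theory Submission
  imports Defs
begin

text \<open>All four kinds of hypersurfaces are sections of the hyperboloid by affine hyperplanes
  \<open>{x. \<langle>x, w\<rangle> = l}\<close> with \<open>w \<noteq> 0\<close>, and the determinant detects whether one affine hyperplane contains all
  the points.

  For the determinant: \<open>sinh\<^sup>2 (\<rho> / 2) = (cosh \<rho> - 1) / 2\<close>, so \<open>B\<^sub>i\<^sub>j = - (\<langle>v\<^sub>i, v\<^sub>j\<rangle> + 1) / 2\<close>. Up to the factor
  this is the Gram matrix of the \<open>n + 2\<close> vectors \<open>(v\<^sub>i, 1)\<close> for the nondegenerate form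
  \<open>\<langle>x, y\<rangle> + s t\<close> on a space of dimension \<open>n + 2\<close>. It is singular iff these vectors are linearly
  dependent, that is, iff the \<open>v\<^sub>i\<close> lie on an affine hyperplane (\<open>det_sum_inner_eq_0_iff\<close>).

  For the geometry (\<open>hyp_section_classification\<close>): a section with lightlike, timelike or spacelike \<open>w\<close> and
  \<open>l \<noteq> 0\<close> is a horosphere, a hypersphere (or a single point), or a branch of an equidistant hypersurface,
  and one with \<open>l = 0\<close> is a hyperplane. The equidistant case carries most of the work, because a branch is
  a connected component of a locus defined by an infimum of distances. Projection to the hyperplane
  \<open>w\<^sup>\<bottom>\<close> computes the infimum (\<open>hdist_to_hyperplane\<close>), so that the locus is the union of the sections at
  \<open>l\<close> and \<open>- l\<close>; each of them is a continuous image of a convex cone, hence connected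
  (\<open>connected_hyp_section\<close>), and \<open>\<langle>_, w\<rangle>\<close> separates them.\<close>

section \<open>The Lorentzian product\<close>

lemma bounded_bilinear_lorentz_inner: "bounded_bilinear lorentz_inner"
  unfolding bilinear_conv_bounded_bilinear [symmetric] bilinear_def linear_iff
  by (auto simp: lorentz_inner_def inner_simps algebra_simps)

interpretation lorentz_inner: bounded_bilinear lorentz_inner
  by (rule bounded_bilinear_lorentz_inner)

lemmas lorentz_inner_simps =
  lorentz_inner.add_left lorentz_inner.add_right lorentz_inner.diff_left lorentz_inner.diff_right
  lorentz_inner.minus_left lorentz_inner.minus_right
  lorentz_inner.scaleR_left lorentz_inner.scaleR_right

lemma lorentz_inner_commute: "lorentz_inner x y = lorentz_inner y x"
  by (simp add: lorentz_inner_def inner_commute mult.commute)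

text \<open>Negating the time coordinate of one factor turns the Lorentzian product into the Euclidean
  one; this is how facts about Euclidean orthogonal complements are transferred.\<close>

definition time_reflect :: "'n::finite lorentz \<Rightarrow> 'n lorentz" where
  "time_reflect x = (fst x, - snd x)"

lemma lorentz_inner_eq_inner: "lorentz_inner x y = x \<bullet> time_reflect y"
  by (simp add: lorentz_inner_def time_reflect_def inner_prod_def)

lemma time_reflect_involution [simp]: "time_reflect (time_reflect x) = x"
  by (simp add: time_reflect_def)

lemma time_reflect_eq_0_iff [simp]: "time_reflect x = 0 \<longleftrightarrow> x = 0"
  by (simp add: time_reflect_def prod_eq_iff)

lemma future_timelike_iff:
  "norm (fst x) < snd x \<longleftrightarrow> lorentz_inner x x < 0 \<and> snd x > 0"
proof -
  have "lorentz_inner x x = (norm (fst x))\<^sup>2 - (snd x)\<^sup>2"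
    unfolding power2_norm_eq_inner by (simp add: lorentz_inner_def power2_eq_square)
  then show ?thesis
    using power_strict_mono [of "norm (fst x)" "snd x" 2] power2_less_imp_less [of "norm (fst x)" "snd x"]
      norm_ge_zero [of "fst x"] by (smt (verit) zero_less_numeral)
qed

lemma hyperboloid_future: "x \<in> hyperboloid \<Longrightarrow> norm (fst x) < snd x"
  by (simp add: future_timelike_iff hyperboloid_def)

lemma hyperboloid_self: "x \<in> hyperboloid \<Longrightarrow> lorentz_inner x x = - 1"
  by (simp add: hyperboloid_def)

lemma future_timelike_inner_neg:
  assumes "norm (fst x) < snd x" "norm (fst y) < snd y"
  shows "lorentz_inner x y < 0"
proof -
  have "fst x \<bullet> fst y \<le> norm (fst x) * norm (fst y)"
    by (rule norm_cauchy_schwarz)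
  also have "\<dots> < snd x * snd y"
    using assms by (intro mult_strict_mono') auto
  finally show ?thesis
    by (simp add: lorentz_inner_def)
qed

text \<open>The form has only one negative direction, and \<open>x\<close> uses it up.\<close>

lemma orthogonal_to_timelike_spacelike:
  assumes "norm (fst x) < snd x" "lorentz_inner x w = 0" "w \<noteq> 0"
  shows "lorentz_inner w w > 0"
proof -
  have eq: "fst x \<bullet> fst w = snd x * snd w"
    using assms(2) by (simp add: lorentz_inner_def)
  have pos: "snd x > 0"
    using assms(1) norm_ge_zero [of "fst x"] by linarith
  have fst_nz: "fst w \<noteq> 0"
    using eq pos assms(3) by (auto simp: prod_eq_iff)
  have "snd x * \<bar>snd w\<bar> = \<bar>fst x \<bullet> fst w\<bar>"
    using eq pos by (simp add: abs_mult)
  also have "\<dots> \<le> norm (fst x) * norm (fst w)"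
    by (rule Cauchy_Schwarz_ineq2)
  also have "\<dots> < snd x * norm (fst w)"
    using assms(1) fst_nz by simp
  finally have "\<bar>snd w\<bar> < norm (fst w)"
    using pos by simp
  then have "\<bar>snd w\<bar>\<^sup>2 < (norm (fst w))\<^sup>2"
    by (intro power_strict_mono) auto
  then show ?thesis
    unfolding power2_norm_eq_inner by (simp add: lorentz_inner_def power2_eq_square)
qed

text \<open>The reversed Cauchy--Schwarz inequality with its equality case: the component of \<open>y\<close> orthogonal
  to \<open>x\<close> has square norm \<open>m\<^sup>2 - 1\<close>, where \<open>m\<close> is the negated product.\<close>

lemma hyperboloid_inner:
  assumes x: "x \<in> hyperboloid" and y: "y \<in> hyperboloid"
  shows "- lorentz_inner x y \<ge> 1" and "- lorentz_inner x y = 1 \<longleftrightarrow> x = y"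
proof -
  define m where "m = - lorentz_inner x y"
  define z where "z = y - m *\<^sub>R x"
  have m_pos: "m > 0"
    using future_timelike_inner_neg x y hyperboloid_future unfolding m_def by fastforce
  have orth: "lorentz_inner x z = 0"
    using x by (simp add: z_def m_def lorentz_inner_simps hyperboloid_self)
  have "lorentz_inner z z = - 1 + 2 * m * m - m * m"
    using x y by (simp add: z_def m_def lorentz_inner_simps hyperboloid_self
        lorentz_inner_commute [of y x])
  then have zz: "lorentz_inner z z = m\<^sup>2 - 1"
    by (simp add: power2_eq_square)
  show "- lorentz_inner x y \<ge> 1"
  proof (cases "z = 0")
    case False
    then have "1\<^sup>2 < m\<^sup>2"
      using orthogonal_to_timelike_spacelike [OF hyperboloid_future [OF x] orth] zz by simp
    then show ?thesis
      using m_pos power2_less_imp_less [of 1 m] by (simp add: m_def)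
  next
    case True
    then have "m\<^sup>2 = 1\<^sup>2"
      using zz by (simp add: lorentz_inner.zero_left)
    then have "m = 1"
      using m_pos by (simp only: power2_eq_iff) linarith
    then show ?thesis
      by (simp add: m_def)
  qed
  show "- lorentz_inner x y = 1 \<longleftrightarrow> x = y"
  proof
    assume "- lorentz_inner x y = 1"
    then have "m = 1"
      by (simp add: m_def)
    then have "z = 0"
      using orthogonal_to_timelike_spacelike [OF hyperboloid_future [OF x] orth] zz by auto
    then show "x = y"
      using \<open>m = 1\<close> by (simp add: z_def)
  next
    assume "x = y"
    then show "- lorentz_inner x y = 1"
      using x by (simp add: hyperboloid_self)
  qed
qed

lemma hyperboloidI_inner_neg:
  assumes "lorentz_inner p p = - 1" "x \<in> hyperboloid" "lorentz_inner x p < 0"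
  shows "p \<in> hyperboloid"
proof -
  have "snd p > 0"
  proof (rule ccontr)
    assume "\<not> snd p > 0"
    moreover have "snd p \<noteq> 0"
      using assms(1) inner_ge_zero [of "fst p"]
      by (auto simp: lorentz_inner_def simp del: inner_ge_zero)
    ultimately have "- p \<in> hyperboloid"
      using assms(1) by (simp add: hyperboloid_def lorentz_inner_simps)
    then show False
      using hyperboloid_inner(1) [OF assms(2), of "- p"] assms(3)
      by (simp add: lorentz_inner_simps)
  qed
  then show ?thesis
    using assms(1) by (simp add: hyperboloid_def)
qed

lemma hyperboloid_scaled_timelike:
  assumes "lorentz_inner w w < 0" "x \<in> hyperboloid"
  obtains a where "a \<noteq> 0" "a *\<^sub>R w \<in> hyperboloid"
proof -
  define s where "s = sqrt (- lorentz_inner w w)"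
  have s: "s > 0" "s * s = - lorentz_inner w w"
    using assms(1) by (simp_all add: s_def)
  have w_nz: "snd w \<noteq> 0"
    using assms(1) inner_ge_zero [of "fst w"]
    by (auto simp: lorentz_inner_def simp del: inner_ge_zero)
  define a where "a = sgn (snd w) / s"
  have sgn2: "sgn (snd w) * sgn (snd w) = 1"
    using w_nz by (simp add: sgn_if)
  have "a \<noteq> 0"
    using w_nz s by (simp add: a_def sgn_if)
  moreover have "a *\<^sub>R w \<in> hyperboloid"
  proof -
    have "a * a * (s * s) = 1"
      using s(1) sgn2 by (simp add: a_def field_simps)
    then have "lorentz_inner (a *\<^sub>R w) (a *\<^sub>R w) = - 1"
      using s(2) by (simp add: lorentz_inner_simps algebra_simps)
    moreover have "snd (a *\<^sub>R w) > 0"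
      using w_nz s by (simp add: a_def sgn_if)
    ultimately show ?thesis
      by (simp add: hyperboloid_def)
  qed
  ultimately show ?thesis
    by (rule that)
qed

lemma hdist_eq_iff:
  assumes "x \<in> hyperboloid" "y \<in> hyperboloid" "r \<ge> 0"
  shows "hdist x y = r \<longleftrightarrow> - lorentz_inner x y = cosh r"
  using hyperboloid_inner(1) [OF assms(1,2)] assms(3)
  by (metis arcosh_cosh_real cosh_arcosh_real hdist_def)

lemma sinh_half_hdist:
  assumes "x \<in> hyperboloid" "y \<in> hyperboloid"
  shows "(sinh (hdist x y / 2))\<^sup>2 = - (lorentz_inner x y + 1) / 2"
proof -
  have "cosh (hdist x y) = - lorentz_inner x y"
    using hyperboloid_inner(1) [OF assms] by (simp add: hdist_def)
  moreover have "cosh (hdist x y) = 1 + 2 * (sinh (hdist x y / 2))\<^sup>2"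
    using cosh_double [of "hdist x y / 2"] by (simp add: cosh_square_eq)
  ultimately show ?thesis
    by simp
qed

section \<open>Sections of the hyperboloid by affine hyperplanes\<close>

definition hyp_section :: "'n::finite lorentz \<Rightarrow> real \<Rightarrow> 'n lorentz set" where
  "hyp_section w l = {x \<in> hyperboloid. lorentz_inner x w = l}"

lemma hyp_section_scale:
  "a \<noteq> 0 \<Longrightarrow> hyp_section (a *\<^sub>R w) (a * l) = hyp_section w l"
  by (simp add: hyp_section_def lorentz_inner_simps)

lemma hyp_section_normalize:
  assumes "lorentz_inner w w > 0"
  obtains a where "a > 0" "lorentz_inner (a *\<^sub>R w) (a *\<^sub>R w) = 1"
proof
  show "1 / sqrt (lorentz_inner w w) > 0"
    using assms by simp
  show "lorentz_inner ((1 / sqrt (lorentz_inner w w)) *\<^sub>R w)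
      ((1 / sqrt (lorentz_inner w w)) *\<^sub>R w) = 1"
    using assms by (simp add: lorentz_inner_simps real_div_sqrt)
qed

text \<open>The component of \<open>x\<close> orthogonal to the unit normal \<open>w\<close> has square norm \<open>- (1 + \<langle>x, w\<rangle>\<^sup>2)\<close>, so
  rescaling it gives a point of the hyperboloid, on the same sheet as \<open>x\<close> because its product with \<open>x\<close> is
  negative.\<close>

lemma foot_of_perpendicular:
  assumes x: "x \<in> hyperboloid" and w: "lorentz_inner w w = 1"
  obtains p where "p \<in> hyp_section w 0"
    "x = lorentz_inner x w *\<^sub>R w + sqrt (1 + (lorentz_inner x w)\<^sup>2) *\<^sub>R p"
proof -
  define l where "l = lorentz_inner x w"
  define s where "s = sqrt (1 + l\<^sup>2)"
  have s_pos: "s > 0" and ss: "s * s = 1 + l * l"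
    by (simp_all add: s_def add_pos_nonneg power2_eq_square)
  define p where "p = (1 / s) *\<^sub>R (x - l *\<^sub>R w)"
  have wx: "lorentz_inner w x = l"
    by (simp add: l_def lorentz_inner_commute)
  have sp: "s *\<^sub>R p = x - l *\<^sub>R w"
    using s_pos by (simp add: p_def)
  have "s * s * lorentz_inner p p = lorentz_inner (s *\<^sub>R p) (s *\<^sub>R p)"
    by (simp add: lorentz_inner_simps)
  also have "\<dots> = - (s * s)"
    unfolding sp ss using x w wx
    by (simp add: lorentz_inner_simps hyperboloid_self l_def [symmetric])
  finally have "(s * s) * (lorentz_inner p p + 1) = 0"
    by (simp add: algebra_simps)
  then have pp: "lorentz_inner p p = - 1"
    using s_pos by simp
  have "s * lorentz_inner x p = lorentz_inner x (s *\<^sub>R p)"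
    by (simp add: lorentz_inner_simps)
  also have "\<dots> = - (s * s)"
    unfolding sp ss using x by (simp add: lorentz_inner_simps hyperboloid_self l_def [symmetric])
  finally have "s * (lorentz_inner x p + s) = 0"
    by (simp add: algebra_simps)
  then have "lorentz_inner x p = - s"
    using s_pos by (simp add: add_eq_0_iff2)
  then have "p \<in> hyperboloid"
    using hyperboloidI_inner_neg [OF pp x] s_pos by simp
  moreover have "lorentz_inner p w = 0"
    by (simp add: p_def lorentz_inner_simps w l_def [symmetric])
  moreover have "x = l *\<^sub>R w + s *\<^sub>R p"
    using sp by simp
  ultimately show ?thesis
    by (intro that) (auto simp: hyp_section_def l_def s_def)
qed

lemma hyp_section_0_nonempty:
  assumes "lorentz_inner w w = 1"
  shows "hyp_section w 0 \<noteq> {}"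
proof -
  have "(0, 1) \<in> hyperboloid"
    by (simp add: hyperboloid_def lorentz_inner_def)
  then obtain p where "p \<in> hyp_section w 0"
    using foot_of_perpendicular assms by blast
  then show ?thesis
    by blast
qed

text \<open>The point at signed distance \<open>arsinh l\<close> from \<open>p\<close> on the geodesic perpendicular to the hyperplane.
  Together with the foot of the perpendicular it identifies every \<open>hyp_section w l\<close> with
  \<open>hyp_section w 0\<close>.\<close>

lemma perpendicular_translate:
  assumes p: "p \<in> hyp_section w 0" and w: "lorentz_inner w w = 1"
  shows "l *\<^sub>R w + sqrt (1 + l\<^sup>2) *\<^sub>R p \<in> hyp_section w l"
proof -
  define s where "s = sqrt (1 + l\<^sup>2)"
  have s_pos: "s > 0" and ss: "s * s = 1 + l * l"
    by (simp_all add: s_def add_pos_nonneg power2_eq_square)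
  define x where "x = l *\<^sub>R w + s *\<^sub>R p"
  have pH: "p \<in> hyperboloid" and pw: "lorentz_inner p w = 0" "lorentz_inner w p = 0"
    using p by (auto simp: hyp_section_def lorentz_inner_commute)
  have "lorentz_inner x x = l * l - s * s"
    using w pw pH by (simp add: x_def lorentz_inner_simps hyperboloid_self)
  then have "lorentz_inner x x = - 1"
    by (simp add: ss)
  moreover have "lorentz_inner p x < 0"
    using pw pH s_pos by (simp add: x_def lorentz_inner_simps hyperboloid_self)
  ultimately have "x \<in> hyperboloid"
    using hyperboloidI_inner_neg pH by blast
  moreover have "lorentz_inner x w = l"
    using pw w by (simp add: x_def lorentz_inner_simps)
  ultimately show ?thesis
    by (simp add: hyp_section_def x_def s_def)
qed

lemma hyp_section_eq_image:
  assumes "lorentz_inner w w = 1"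
  shows "hyp_section w l = (\<lambda>p. l *\<^sub>R w + sqrt (1 + l\<^sup>2) *\<^sub>R p) ` hyp_section w 0"
proof (intro equalityI subsetI)
  fix x assume "x \<in> hyp_section w l"
  then have "x \<in> hyperboloid" "lorentz_inner x w = l"
    by (auto simp: hyp_section_def)
  then show "x \<in> (\<lambda>p. l *\<^sub>R w + sqrt (1 + l\<^sup>2) *\<^sub>R p) ` hyp_section w 0"
    using foot_of_perpendicular [OF _ assms, of x] by blast
qed (use perpendicular_translate assms in blast)

text \<open>A hyperplane is the radial projection of a convex cone, the future timelike cone in the
  orthogonal complement of \<open>w\<close>.\<close>

lemma connected_hyp_section_0: "connected (hyp_section w 0)"
proof -
  define K where "K = {y :: 'a lorentz. norm (fst y) < snd y \<and> lorentz_inner y w = 0}"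
  have "convex K"
  proof (rule convexI)
    fix x y :: "'a lorentz" and u v :: real
    assume xy: "x \<in> K" "y \<in> K" and uv: "0 \<le> u" "0 \<le> v" "u + v = 1"
    have "norm (fst (u *\<^sub>R x + v *\<^sub>R y)) \<le> u * norm (fst x) + v * norm (fst y)"
      using norm_triangle_ineq [of "u *\<^sub>R fst x" "v *\<^sub>R fst y"] uv by simp
    also have "\<dots> < u * snd x + v * snd y"
    proof (cases "u = 0")
      case True
      then show ?thesis using xy uv by (simp add: K_def)
    next
      case False
      then have "u * norm (fst x) < u * snd x" "v * norm (fst y) \<le> v * snd y"
        using xy uv by (auto simp: K_def intro: mult_left_mono)
      then show ?thesis by linarith
    qed
    finally show "u *\<^sub>R x + v *\<^sub>R y \<in> K"
      using xy by (simp add: K_def lorentz_inner_simps)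
  qed
  then have "connected K"
    by (rule convex_connected)
  define f where "f = (\<lambda>y :: 'a lorentz. (1 / sqrt (- lorentz_inner y y)) *\<^sub>R y)"
  have neg: "lorentz_inner y y < 0" "snd y > 0" if "y \<in> K" for y
    using that by (auto simp: K_def future_timelike_iff)
  have "continuous_on K f"
    unfolding f_def
    by (intro continuous_intros lorentz_inner.continuous_on) (auto dest: neg)
  moreover have "hyp_section w 0 = f ` K"
  proof (intro equalityI subsetI)
    fix x assume "x \<in> hyp_section w 0"
    then have "x \<in> K" "f x = x"
      by (auto simp: hyp_section_def K_def hyperboloid_future f_def hyperboloid_self)
    then show "x \<in> f ` K"
      by force
  next
    fix x assume "x \<in> f ` K"
    then obtain y where y: "y \<in> K" "x = f y"
      by blast
    have "lorentz_inner x x = - 1"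
      using neg [OF y(1)] by (simp add: y(2) f_def lorentz_inner_simps real_sqrt_mult_self field_simps)
    moreover have "snd x > 0"
      using neg [OF y(1)] by (simp add: y(2) f_def)
    ultimately show "x \<in> hyp_section w 0"
      using y by (simp add: hyp_section_def hyperboloid_def f_def K_def lorentz_inner_simps)
  qed
  ultimately show ?thesis
    using \<open>connected K\<close> connected_continuous_image by metis
qed

lemma connected_hyp_section:
  assumes "lorentz_inner w w = 1"
  shows "connected (hyp_section w l)"
  unfolding hyp_section_eq_image [OF assms, of l]
  by (intro connected_continuous_image connected_hyp_section_0 continuous_intros)

section \<open>The four kinds of hypersurfaces as sections\<close>

lemma hyp_horosphere_iff:
  "hyp_horosphere S \<longleftrightarrow>
     S \<noteq> {} \<and> (\<exists>w. w \<noteq> 0 \<and> lorentz_inner w w = 0 \<and> S = hyp_section w (- 1 / sqrt 2))"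
  by (simp add: hyp_horosphere_def lightlike_def hyp_section_def)

lemma hyp_hypersphere_iff:
  "hyp_hypersphere S \<longleftrightarrow> (\<exists>c\<in>hyperboloid. \<exists>k>1. S = hyp_section c (- k))"
proof
  assume "hyp_hypersphere S"
  then obtain c r where c: "c \<in> hyperboloid" "r > 0" "S = {x \<in> hyperboloid. hdist x c = r}"
    by (auto simp: hyp_hypersphere_def)
  have "S = hyp_section c (- cosh r)"
    using c hdist_eq_iff [OF _ c(1), of _ r] by (force simp: hyp_section_def)
  moreover have "cosh r > 1"
    using c(2) cosh_real_strict_mono [of 0 r] by simp
  ultimately show "\<exists>c\<in>hyperboloid. \<exists>k>1. S = hyp_section c (- k)"
    using c(1) by blast
next
  assume "\<exists>c\<in>hyperboloid. \<exists>k>1. S = hyp_section c (- k)"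
  then obtain c k where c: "c \<in> hyperboloid" "k > 1" "S = hyp_section c (- k)"
    by blast
  have r: "arcosh k > 0" "cosh (arcosh k) = k"
    using c(2) by simp_all
  have "S = {x \<in> hyperboloid. hdist x c = arcosh k}"
    using c hdist_eq_iff [OF _ c(1), of _ "arcosh k"] r by (force simp: hyp_section_def)
  then show "hyp_hypersphere S"
    using c(1) r(1) by (auto simp: hyp_hypersphere_def)
qed

text \<open>The normal of a subspace that meets the hyperboloid is orthogonal to a timelike vector, hence
  spacelike, and can be taken to be a unit vector.\<close>

lemma hyp_hyperplane_section:
  assumes "w \<noteq> 0" "hyp_section w 0 \<noteq> {}"
  obtains u where "lorentz_inner u u = 1" "hyp_section u 0 = hyp_section w 0"
proof -
  obtain x where "x \<in> hyp_section w 0"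
    using assms(2) by blast
  then have "lorentz_inner w w > 0"
    using orthogonal_to_timelike_spacelike [of x w] assms(1)
    by (simp add: hyp_section_def hyperboloid_future)
  then obtain a where "a > 0" "lorentz_inner (a *\<^sub>R w) (a *\<^sub>R w) = 1"
    by (rule hyp_section_normalize)
  then show ?thesis
    using that [of "a *\<^sub>R w"] hyp_section_scale [of a w 0] by simp
qed

lemma hyp_hyperplane_iff:
  fixes P :: "'n::finite lorentz set"
  shows "hyp_hyperplane P \<longleftrightarrow> (\<exists>w. lorentz_inner w w = 1 \<and> P = hyp_section w 0)"
proof
  assume "hyp_hyperplane P"
  then obtain W where W: "subspace W" "dim W + 1 = DIM('n lorentz)" "P = hyperboloid \<inter> W"
    and P: "P \<noteq> {}"
    by (auto simp: hyp_hyperplane_def)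
  have "dim W < DIM('n lorentz)"
    using W(2) by linarith
  then obtain z where z: "z \<noteq> 0" "\<And>y. y \<in> span W \<Longrightarrow> orthogonal z y"
    by (rule orthogonal_to_subspace_exists) blast
  have "W = {x. z \<bullet> x = 0}"
  proof (rule subspace_dim_equal)
    show "W \<subseteq> {x. z \<bullet> x = 0}"
      using z(2) by (auto simp: orthogonal_def span_base)
    show "dim {x. z \<bullet> x = 0} \<le> dim W"
      using W(2) z(1) by (simp add: dim_hyperplane)
  qed (use W(1) subspace_hyperplane in auto)
  then have P_eq: "P = hyp_section (time_reflect z) 0"
    using W(3) by (auto simp: hyp_section_def lorentz_inner_eq_inner inner_commute)
  then show "\<exists>w. lorentz_inner w w = 1 \<and> P = hyp_section w 0"
    using hyp_hyperplane_section [of "time_reflect z"] z(1) P by (metis time_reflect_eq_0_iff)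
next
  assume "\<exists>w. lorentz_inner w w = 1 \<and> P = hyp_section w 0"
  then obtain w where w: "lorentz_inner w w = 1" "P = hyp_section w 0"
    by blast
  have "w \<noteq> 0"
    using w(1) by (auto simp: lorentz_inner.zero_left)
  then have "dim {x. time_reflect w \<bullet> x = 0} = DIM('n lorentz) - 1"
    by (intro dim_hyperplane) simp
  moreover have "P = hyperboloid \<inter> {x. time_reflect w \<bullet> x = 0}"
    by (auto simp: w(2) hyp_section_def lorentz_inner_eq_inner inner_commute)
  ultimately show "hyp_hyperplane P"
    unfolding hyp_hyperplane_def
    using hyp_section_0_nonempty [OF w(1)] w(2) subspace_hyperplane [of "time_reflect w"]
    by (intro conjI exI [of _ "{x. time_reflect w \<bullet> x = 0}"]) auto
qed

text \<open>The foot \<open>p\<close> of the perpendicular realizes the distance: on the hyperplane \<open>\<langle>x, _\<rangle>\<close> is a positive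
  multiple of \<open>\<langle>p, _\<rangle>\<close>, and \<open>- \<langle>p, q\<rangle>\<close> is smallest for \<open>q = p\<close>.\<close>

lemma hdist_to_hyperplane:
  assumes x: "x \<in> hyperboloid" and w: "lorentz_inner w w = 1"
  shows "hdist_to_set x (hyp_section w 0) = arcosh (sqrt (1 + (lorentz_inner x w)\<^sup>2))"
proof -
  define l where "l = lorentz_inner x w"
  define s where "s = sqrt (1 + l\<^sup>2)"
  have s: "s \<ge> 1"
    by (simp add: s_def)
  obtain p where p: "p \<in> hyp_section w 0" "x = l *\<^sub>R w + s *\<^sub>R p"
    using foot_of_perpendicular [OF x w] unfolding l_def s_def by blast
  have pH: "p \<in> hyperboloid"
    using p(1) by (simp add: hyp_section_def)
  have inner_x: "- lorentz_inner x q = s * - lorentz_inner p q" if "q \<in> hyp_section w 0" for q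
    using that by (simp add: p(2) lorentz_inner_simps hyp_section_def lorentz_inner_commute [of w q])
  have "hdist x p = arcosh s"
    using inner_x [OF p(1)] pH by (simp add: hdist_def hyperboloid_self)
  moreover have "arcosh s \<le> hdist x q" if q: "q \<in> hyp_section w 0" for q
  proof -
    have "1 \<le> - lorentz_inner p q"
      using hyperboloid_inner(1) [OF pH] q by (simp add: hyp_section_def)
    then have "s * 1 \<le> - lorentz_inner x q"
      unfolding inner_x [OF q] using s by (intro mult_left_mono) auto
    then show ?thesis
      using s arcosh_real_strict_mono [of s "- lorentz_inner x q"]
      by (fastforce simp: hdist_def le_less)
  qed
  ultimately show ?thesis
    unfolding hdist_to_set_def s_def [symmetric] l_def [symmetric]
    using p(1) by (intro cInf_eq_minimum) (metis imageI, blast)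
qed

lemma equidistant_locus:
  assumes w: "lorentz_inner w w = 1" and r: "r > 0"
  shows "{x \<in> hyperboloid. hdist_to_set x (hyp_section w 0) = r}
    = hyp_section w (sinh r) \<union> hyp_section w (- sinh r)"
proof -
  have "hdist_to_set x (hyp_section w 0) = r \<longleftrightarrow>
      lorentz_inner x w = sinh r \<or> lorentz_inner x w = - sinh r"
    if x: "x \<in> hyperboloid" for x
  proof -
    define s where "s = sqrt (1 + (lorentz_inner x w)\<^sup>2)"
    have "s \<ge> 1"
      by (simp add: s_def)
    then have "arcosh s = r \<longleftrightarrow> s = cosh r"
      using r by (metis arcosh_cosh_real cosh_arcosh_real less_imp_le)
    also have "\<dots> \<longleftrightarrow> s\<^sup>2 = (cosh r)\<^sup>2"
      using \<open>s \<ge> 1\<close> by (auto simp: power2_eq_iff_nonneg)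
    also have "\<dots> \<longleftrightarrow> (lorentz_inner x w)\<^sup>2 = (sinh r)\<^sup>2"
      by (auto simp: s_def cosh_square_eq)
    finally show ?thesis
      using hdist_to_hyperplane [OF x w] by (simp add: s_def power2_eq_iff)
  qed
  then show ?thesis
    by (auto simp: hyp_section_def)
qed

text \<open>The two sections are connected, and a connected set containing points of both would be mapped
  by the linear functional of \<open>w\<close> onto the disconnected set \<open>{c, - c}\<close>.\<close>

lemma hyp_section_component:
  assumes w: "lorentz_inner w w = 1" and c: "c \<noteq> 0"
  shows "hyp_section w c \<in> components (hyp_section w c \<union> hyp_section w (- c))"
  unfolding in_components_maximal
proof (intro conjI allI impI)
  show "hyp_section w c \<noteq> {}"
    using hyp_section_0_nonempty [OF w] hyp_section_eq_image [OF w, of c] by simp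
  show "connected (hyp_section w c)"
    by (rule connected_hyp_section [OF w])
  fix D
  assume D: "D \<noteq> {} \<and> hyp_section w c \<subseteq> D \<and> D \<subseteq> hyp_section w c \<union> hyp_section w (- c) \<and> connected D"
  have "continuous_on D (\<lambda>x. lorentz_inner x w)"
    by (intro lorentz_inner.continuous_on continuous_intros)
  then have "connected ((\<lambda>x. lorentz_inner x w) ` D)"
    using D connected_continuous_image by blast
  moreover have "(\<lambda>x. lorentz_inner x w) ` D \<subseteq> {c, - c}"
    using D by (auto simp: hyp_section_def)
  then have "finite ((\<lambda>x. lorentz_inner x w) ` D)"
    by (rule finite_subset) simp
  ultimately have "(\<lambda>x. lorentz_inner x w) ` D = {} \<or> (\<exists>b. (\<lambda>x. lorentz_inner x w) ` D = {b})"
    by (simp only: connected_finite_iff_sing)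
  then obtain b where b: "(\<lambda>x. lorentz_inner x w) ` D = {b}"
    using D by auto
  obtain x where "x \<in> hyp_section w c"
    using \<open>hyp_section w c \<noteq> {}\<close> by blast
  then have "x \<in> D" "lorentz_inner x w = c"
    using D by (auto simp: hyp_section_def)
  then have "b = c"
    using b by force
  then show "D = hyp_section w c"
    using b D by (fastforce simp: hyp_section_def)
qed auto

lemma equidistant_branch_iff:
  "equidistant_branch S \<longleftrightarrow> (\<exists>w l. lorentz_inner w w = 1 \<and> l \<noteq> 0 \<and> S = hyp_section w l)"
proof
  assume "equidistant_branch S"
  then obtain w r where w: "lorentz_inner w w = 1" "r > 0"
    and S: "S \<in> components (hyp_section w (sinh r) \<union> hyp_section w (- sinh r))"
    by (auto simp: equidistant_branch_def hyp_hyperplane_iff equidistant_locus)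
  have nz: "sinh r \<noteq> 0"
    using w(2) by simp
  have comp: "hyp_section w (sinh r) \<in> components (hyp_section w (sinh r) \<union> hyp_section w (- sinh r))"
    "hyp_section w (- sinh r) \<in> components (hyp_section w (sinh r) \<union> hyp_section w (- sinh r))"
    using hyp_section_component [OF w(1), of "sinh r"] hyp_section_component [OF w(1), of "- sinh r"] nz
    by (simp_all add: Un_commute)
  have "S \<noteq> {}" "S \<subseteq> hyp_section w (sinh r) \<union> hyp_section w (- sinh r)"
    using S by (auto dest: in_components_nonempty in_components_subset)
  then have "S \<inter> hyp_section w (sinh r) \<noteq> {} \<or> S \<inter> hyp_section w (- sinh r) \<noteq> {}"
    by blast
  then have "S = hyp_section w (sinh r) \<or> S = hyp_section w (- sinh r)"
    using components_nonoverlap [OF S comp(1)] components_nonoverlap [OF S comp(2)] by blast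
  then show "\<exists>w l. lorentz_inner w w = 1 \<and> l \<noteq> 0 \<and> S = hyp_section w l"
    using w(1) nz by (metis neg_equal_0_iff_equal)
next
  assume "\<exists>w l. lorentz_inner w w = 1 \<and> l \<noteq> 0 \<and> S = hyp_section w l"
  then obtain w l where w: "lorentz_inner w w = 1" "l \<noteq> 0" "S = hyp_section w l"
    by blast
  define r where "r = arsinh \<bar>l\<bar>"
  have r: "r > 0" "sinh r = \<bar>l\<bar>"
    using w(2) by (simp_all add: r_def)
  have "hyp_section w (sinh r) \<union> hyp_section w (- sinh r) = hyp_section w l \<union> hyp_section w (- l)"
    by (cases "l > 0") (auto simp: r(2) Un_commute)
  then have "S \<in> components {x \<in> hyperboloid. hdist_to_set x (hyp_section w 0) = r}"
    using hyp_section_component [OF w(1,2)] w(3) by (simp add: equidistant_locus w(1) r(1))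
  then show "equidistant_branch S"
    unfolding equidistant_branch_def hyp_hyperplane_iff using w(1) r(1) by blast
qed

text \<open>For a section by an affine hyperplane off the origin the causal type of the normal vector decides
  the kind. The one exception is a hyperplane tangent to the hyperboloid, whose section is a single point
  rather than a hypersphere; then some hyperplane through that point contains \<open>A\<close>.\<close>

lemma hyp_section_classification:
  fixes A :: "'n::finite lorentz set"
  assumes A: "A \<noteq> {}"
  shows "(\<exists>S. hyp_horosphere S \<and> A \<subseteq> S) \<or> (\<exists>S. hyp_hypersphere S \<and> A \<subseteq> S) \<or>
      (\<exists>S. hyp_hyperplane S \<and> A \<subseteq> S) \<or> (\<exists>S. equidistant_branch S \<and> A \<subseteq> S) \<longleftrightarrow>
    (\<exists>w l. w \<noteq> 0 \<and> A \<subseteq> hyp_section w l)"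
  (is "?horo \<or> ?sphere \<or> ?plane \<or> ?branch \<longleftrightarrow> ?sec")
proof
  assume "?horo \<or> ?sphere \<or> ?plane \<or> ?branch"
  moreover have "c \<noteq> 0" if "c \<in> hyperboloid" for c :: "'n lorentz"
    using that by (auto simp: hyperboloid_def)
  moreover have "w \<noteq> 0" if "lorentz_inner w w = 1" for w :: "'n lorentz"
    using that by (auto simp: lorentz_inner.zero_left)
  ultimately show ?sec
    unfolding hyp_horosphere_iff hyp_hypersphere_iff hyp_hyperplane_iff equidistant_branch_iff
    by blast
next
  assume ?sec
  then obtain w l where w: "w \<noteq> 0" and sub: "A \<subseteq> hyp_section w l"
    by blast
  have plane: ?plane if "u \<noteq> 0" "A \<subseteq> hyp_section u 0" for u
    using hyp_hyperplane_section [of u] that A unfolding hyp_hyperplane_iff by (metis subset_empty)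
  obtain x where x: "x \<in> hyperboloid" "lorentz_inner x w = l"
    using A sub by (auto simp: hyp_section_def)
  consider "l = 0" | "l \<noteq> 0" "lorentz_inner w w = 0" | "l \<noteq> 0" "lorentz_inner w w > 0"
    | "lorentz_inner w w < 0"
    by linarith
  then show "?horo \<or> ?sphere \<or> ?plane \<or> ?branch"
  proof cases
    case 1
    then show ?thesis
      using plane [OF w] sub by simp
  next
    case 2
    \<comment> \<open>The scaling that brings the value \<open>l\<close> to the one in the definition of a horosphere.\<close>
    define a where "a = - 1 / (sqrt 2 * l)"
    have a: "a \<noteq> 0" "a * l = - 1 / sqrt 2"
      using 2 by (simp_all add: a_def)
    then have "hyp_section (a *\<^sub>R w) (- 1 / sqrt 2) = hyp_section w l"
      using hyp_section_scale [of a w l] by simp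
    then have "hyp_horosphere (hyp_section w l)"
      unfolding hyp_horosphere_iff using A sub a(1) w 2
      by (intro conjI exI [of _ "a *\<^sub>R w"]) (auto simp: lorentz_inner_simps)
    then show ?thesis
      using sub by blast
  next
    case 3
    obtain a where a: "a > 0" "lorentz_inner (a *\<^sub>R w) (a *\<^sub>R w) = 1"
      using hyp_section_normalize [OF 3(2)] .
    then have "hyp_section w l = hyp_section (a *\<^sub>R w) (a * l)"
      by (simp add: hyp_section_scale)
    then have "equidistant_branch (hyp_section w l)"
      unfolding equidistant_branch_iff using a 3(1) by (metis less_irrefl mult_eq_0_iff)
    then show ?thesis
      using sub by blast
  next
    case 4
    then obtain a where a: "a \<noteq> 0" "a *\<^sub>R w \<in> hyperboloid"
      using hyperboloid_scaled_timelike x(1) by blast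
    define c k where "c = a *\<^sub>R w" and "k = - (a * l)"
    have c: "c \<in> hyperboloid" and sec: "hyp_section w l = hyp_section c (- k)"
      using a by (simp_all add: c_def k_def hyp_section_scale)
    have "- lorentz_inner x c = k"
      using x by (simp add: c_def k_def lorentz_inner_simps)
    then have "k \<ge> 1"
      using hyperboloid_inner(1) [OF x(1) c] by simp
    then consider "k > 1" | "k = 1"
      by linarith
    then show ?thesis
    proof cases
      case 1
      then have "hyp_hypersphere (hyp_section w l)"
        unfolding hyp_hypersphere_iff sec using c by blast
      then show ?thesis
        using sub by blast
    next
      case 2
      have Ac: "y = c" if "y \<in> A" for y
      proof -
        have "y \<in> hyp_section c (- k)"
          using that sub unfolding sec by blast
        then show ?thesis
          using 2 hyperboloid_inner(2) [OF _ c, of y] by (simp add: hyp_section_def)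
      qed
      have "2 \<le> DIM('n lorentz)"
        by (simp add: Suc_leI)
      then obtain z where z: "z \<noteq> 0" "orthogonal c z"
        using orthogonal_to_vector_exists [of c] by blast
      have "A \<subseteq> hyp_section (time_reflect z) 0"
        using Ac c z(2) by (auto simp: hyp_section_def lorentz_inner_eq_inner orthogonal_def)
      then show ?thesis
        using plane [of "time_reflect z"] z(1) by simp
    qed
  qed
qed

section \<open>The determinant\<close>

text \<open>A linear map between spaces of equal dimension is injective iff it is surjective. For
  \<open>a \<mapsto> \<Sum>j. a\<^sub>j (v\<^sub>j, 1)\<close>, failure of surjectivity means that some nonzero \<open>(z, t)\<close> is orthogonal to
  every \<open>(v\<^sub>j, 1)\<close>, that is, that an affine hyperplane contains all the points.\<close>

lemma affine_dependence_iff_section: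
  fixes v :: "'m::finite \<Rightarrow> 'n::finite lorentz"
  assumes card: "CARD('m) = CARD('n) + 2"
  shows "(\<exists>a :: 'm \<Rightarrow> real. (\<exists>j. a j \<noteq> 0) \<and> (\<Sum>j\<in>UNIV. a j *\<^sub>R v j) = 0 \<and> (\<Sum>j\<in>UNIV. a j) = 0) \<longleftrightarrow>
    (\<exists>w l. w \<noteq> 0 \<and> (\<forall>i. lorentz_inner (v i) w = l))"
proof -
  define T :: "real ^ 'm \<Rightarrow> 'n lorentz \<times> real"
    where "T a = (\<Sum>j\<in>UNIV. a $ j *\<^sub>R (v j, 1))" for a
  have lin: "linear T"
    by (rule linearI) (simp_all only: T_def vector_add_component vector_scaleR_component
        scaleR_add_left sum.distrib scaleR_sum_right scaleR_scaleR real_scaleR_def)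
  have dims: "DIM('n lorentz \<times> real) = DIM(real ^ 'm)"
    using card by simp
  have inj_surj: "inj T \<longleftrightarrow> surj T"
    using linear_injective_imp_surjective [OF lin _] linear_surjective_imp_injective [OF lin _] dims
    by (auto simp: dim_UNIV)
  have T_eq: "T a = (\<Sum>j\<in>UNIV. a $ j *\<^sub>R v j, \<Sum>j\<in>UNIV. a $ j)" for a
    by (simp add: T_def prod_eq_iff fst_sum snd_sum)
  have "(\<exists>a :: 'm \<Rightarrow> real. (\<exists>j. a j \<noteq> 0) \<and> (\<Sum>j\<in>UNIV. a j *\<^sub>R v j) = 0 \<and> (\<Sum>j\<in>UNIV. a j) = 0)
      \<longleftrightarrow> (\<exists>a. a \<noteq> 0 \<and> T a = 0)" (is "(\<exists>a. ?P a) \<longleftrightarrow> _")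
  proof
    assume "\<exists>a. ?P a"
    then obtain a where "?P a" ..
    then have "(\<chi> j. a j) \<noteq> 0 \<and> T (\<chi> j. a j) = 0"
      by (auto simp: T_eq vec_eq_iff prod_eq_iff)
    then show "\<exists>a. a \<noteq> 0 \<and> T a = 0" ..
  next
    assume "\<exists>a. a \<noteq> 0 \<and> T a = 0"
    then obtain a where "a \<noteq> 0" "T a = 0" by blast
    then have "?P (\<lambda>j. a $ j)"
      by (auto simp: T_eq vec_eq_iff zero_prod_def)
    then show "\<exists>a. ?P a" by (rule exI [where P = ?P])
  qed
  also have "\<dots> \<longleftrightarrow> \<not> surj T"
    using linear_injective_0 [OF lin] inj_surj by blast
  also have "\<dots> \<longleftrightarrow> (\<exists>z. z \<noteq> 0 \<and> (\<forall>j. (v j, 1 :: real) \<bullet> z = 0))"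
  proof
    assume "\<not> surj T"
    then have "span (range T) \<noteq> UNIV"
      using span_eq_iff linear_subspace_image [OF lin subspace_UNIV] by metis
    then have "dim (range T) < DIM('n lorentz \<times> real)"
      using dim_eq_full [of "range T"] dim_subset_UNIV [of "range T"] by linarith
    then obtain z where z: "z \<noteq> 0" "\<And>y. y \<in> span (range T) \<Longrightarrow> orthogonal z y"
      by (rule orthogonal_to_subspace_exists) blast
    have "T (axis j 1) = (v j, 1)" for j
      by (simp add: T_eq axis_def if_distrib [of "\<lambda>c. c *\<^sub>R _"] cong: if_cong)
    then have "(v j, 1) \<in> span (range T)" for j
      by (metis rangeI span_base)
    then show "\<exists>z. z \<noteq> 0 \<and> (\<forall>j. (v j, 1 :: real) \<bullet> z = 0)"
      using z by (metis orthogonal_def orthogonal_commute)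
  next
    assume "\<exists>z. z \<noteq> 0 \<and> (\<forall>j. (v j, 1 :: real) \<bullet> z = 0)"
    then obtain z where z: "z \<noteq> 0" "\<And>j. (v j, 1 :: real) \<bullet> z = 0"
      by blast
    have "T a \<bullet> z = 0" for a
      unfolding T_def inner_sum_left inner_scaleR_left z(2) by simp
    then show "\<not> surj T"
      using z(1) by (metis inner_eq_zero_iff surjD)
  qed
  also have "\<dots> \<longleftrightarrow> (\<exists>w l. w \<noteq> 0 \<and> (\<forall>i. lorentz_inner (v i) w = l))"
  proof
    assume "\<exists>z. z \<noteq> 0 \<and> (\<forall>j. (v j, 1 :: real) \<bullet> z = 0)"
    then obtain z t where zt: "(z, t) \<noteq> 0" "\<And>j. (v j, 1 :: real) \<bullet> (z, t) = 0"
      by (metis prod.exhaust)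
    then have "v j \<bullet> z = - t" for j
      by (simp add: eq_neg_iff_add_eq_0)
    moreover from this have "z = 0 \<Longrightarrow> t = 0"
      by simp
    then have "z \<noteq> 0"
      using zt(1) unfolding prod_eq_iff by force
    ultimately show "\<exists>w l. w \<noteq> 0 \<and> (\<forall>i. lorentz_inner (v i) w = l)"
      by (intro exI [of _ "time_reflect z"] exI [of _ "- t"]) (simp add: lorentz_inner_eq_inner)
  next
    assume "\<exists>w l. w \<noteq> 0 \<and> (\<forall>i. lorentz_inner (v i) w = l)"
    then obtain w l where "w \<noteq> 0" "\<And>i. lorentz_inner (v i) w = l"
      by blast
    then show "\<exists>z. z \<noteq> 0 \<and> (\<forall>j. (v j, 1 :: real) \<bullet> z = 0)"
      by (intro exI [of _ "(time_reflect w, - l)"]) (simp add: lorentz_inner_eq_inner prod_eq_iff [of "(_, _)"])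
  qed
  finally show ?thesis .
qed

text \<open>A kernel vector \<open>a\<close> of the matrix either has \<open>w = \<Sum>j. a\<^sub>j v\<^sub>j \<noteq> 0\<close>, and then the kernel equations say
  that \<open>w\<close> has the same product with every \<open>v\<^sub>i\<close>, or it is an affine dependence of the points.\<close>

lemma det_sum_inner_eq_0_iff:
  fixes v :: "'m::finite \<Rightarrow> 'n::finite lorentz" and c :: real
  assumes card: "CARD('m) = CARD('n) + 2" and c: "c \<noteq> 0"
  shows "det (\<chi> i j. c * (lorentz_inner (v i) (v j) + 1) :: real ^ 'm ^ 'm) = 0 \<longleftrightarrow>
    (\<exists>w l. w \<noteq> 0 \<and> (\<forall>i. lorentz_inner (v i) w = l))"
proof -
  define B :: "real ^ 'm ^ 'm" where "B = (\<chi> i j. c * (lorentz_inner (v i) (v j) + 1))"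
  have B_mult: "(B *v a) $ i =
      c * (lorentz_inner (v i) (\<Sum>j\<in>UNIV. a $ j *\<^sub>R v j) + (\<Sum>j\<in>UNIV. a $ j))" for a i
    by (simp add: B_def matrix_vector_mult_def lorentz_inner.sum_right lorentz_inner_simps
        sum_distrib_left sum.distrib [symmetric] algebra_simps)
  have ker: "det B = 0 \<longleftrightarrow> (\<exists>a. a \<noteq> 0 \<and> B *v a = 0)"
    using invertible_det_nz [of B] invertible_left_inverse [of B] matrix_left_invertible_ker [of B]
    by blast
  have "det B = 0 \<longleftrightarrow> (\<exists>w l. w \<noteq> 0 \<and> (\<forall>i. lorentz_inner (v i) w = l))"
  proof
    assume "det B = 0"
    then obtain a where a: "a \<noteq> 0" "B *v a = 0"
      using ker by blast
    define w where "w = (\<Sum>j\<in>UNIV. a $ j *\<^sub>R v j)"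
    have eq: "lorentz_inner (v i) w = - (\<Sum>j\<in>UNIV. a $ j)" for i
      using B_mult [of a i] a(2) c by (simp add: w_def eq_neg_iff_add_eq_0)
    show "\<exists>w l. w \<noteq> 0 \<and> (\<forall>i. lorentz_inner (v i) w = l)"
    proof (cases "w = 0")
      case False
      then show ?thesis
        using eq by blast
    next
      case True
      then have "(\<Sum>j\<in>UNIV. a $ j) = 0"
        using eq by (simp add: lorentz_inner.zero_right)
      then have "(\<exists>j. a $ j \<noteq> 0) \<and> (\<Sum>j\<in>UNIV. a $ j *\<^sub>R v j) = 0 \<and> (\<Sum>j\<in>UNIV. a $ j) = 0"
        using True a(1) by (auto simp: w_def vec_eq_iff)
      then show ?thesis
        using affine_dependence_iff_section [OF card, of v] by blast
    qed
  next
    assume "\<exists>w l. w \<noteq> 0 \<and> (\<forall>i. lorentz_inner (v i) w = l)"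
    then obtain a :: "'m \<Rightarrow> real" where a: "\<exists>j. a j \<noteq> 0"
      "(\<Sum>j\<in>UNIV. a j *\<^sub>R v j) = 0" "(\<Sum>j\<in>UNIV. a j) = 0"
      using affine_dependence_iff_section [OF card, of v] by blast
    have "(\<chi> j. a j) \<noteq> 0" "B *v (\<chi> j. a j) = 0"
      using a by (simp_all add: vec_eq_iff B_mult lorentz_inner.zero_right)
    then show "det B = 0"
      using ker by blast
  qed
  then show ?thesis
    by (simp add: B_def)
qed

theorem theoremB2:
  fixes v :: "'m::finite \<Rightarrow> 'n::finite lorentz"
    and B :: "real ^ 'm ^ 'm"
  assumes "CARD('n) \<ge> 2"
    and "CARD('m) = CARD('n) + 2"
    and "\<And>i. v i \<in> hyperboloid"
    and "B = (\<chi> i j. (sinh (hdist (v i) (v j) / 2))\<^sup>2)"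
  shows "((\<exists>S. hyp_horosphere S \<and> range v \<subseteq> S) \<or>
          (\<exists>S. hyp_hypersphere S \<and> range v \<subseteq> S) \<or>
          (\<exists>S. hyp_hyperplane S \<and> range v \<subseteq> S) \<or>
          (\<exists>S. equidistant_branch S \<and> range v \<subseteq> S))
         \<longleftrightarrow> det B = 0"
proof -
  have "B = (\<chi> i j. (- 1 / 2) * (lorentz_inner (v i) (v j) + 1))"
    unfolding assms(4) sinh_half_hdist [OF assms(3) assms(3)] by (simp add: vec_eq_iff field_simps)
  then have "det B = 0 \<longleftrightarrow> (\<exists>w l. w \<noteq> 0 \<and> (\<forall>i. lorentz_inner (v i) w = l))"
    using det_sum_inner_eq_0_iff [OF assms(2), of "- 1 / 2" v] by simp
  also have "\<dots> \<longleftrightarrow> (\<exists>w l. w \<noteq> 0 \<and> range v \<subseteq> hyp_section w l)"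
    using assms(3) by (auto simp: hyp_section_def image_subset_iff)
  finally show ?thesis
    using hyp_section_classification [of "range v"] by simp
qed

end
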